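(* Let $(X, \mathrm{cl}_X)$ and $(Y, \mathrm{cl}_Y)$ be generalized closure spaces such that $\mathrm{cl}_X$ and $\mathrm{cl}_Y$ are isotonic and $\mathrm{cl}_Y$ is pointwise-symmetric, and let $f: X \to Y$ be a function. Then $f$ is nonseparating if and only if $f$ is continuous.
   Context: A generalized closure space is a pair $(X,\mathrm{cl})$ where $X$ is a set and $\mathrm{cl}$ (the closure function) is an arbitrary function from the power set of $X$ to itself (no further axioms are assumed). $\mathrm{cl}$ is isotonic if $\mathrm{cl}(A)\subseteq \mathrm{cl}(B)$ whenever $A\subseteq B\subseteq X$. $\mathrm{cl}$ is pointwise-symmetric if, for all $x,y\in X$, $x\in \mathrm{cl}(\{y\})$ implies $y\in\mathrm{cl}(\{x\})$. Subsets $A,B\subseteq X$ are $\mathrm{cl}$-separated if $A\cap \mathrm{cl}(B)=\emptyset$ and $\mathrm{cl}(A)\cap B=\emptyset$. A function $f:X\to Y$ between generalized closure spaces $(X,\mathrm{cl}_X)$ and $(Y,\mathrm{cl}_Y)$ is continuous if $\mathrm{cl}_X(f^{-1}(B))\subseteq f^{-1}(\mathrm{cl}_Y(B))$ for each $B\subseteq Y$; it is nonseparating if, for all $A,B\subseteq X$, $f(A)$ and $f(B)$ are not $\mathrm{cl}_Y$-separated whenever $A$ and $B$ are not $\mathrm{cl}_X$-separated. *)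

theory Defs
  imports "HOL-Library.FuncSet"
begin

(* Closure functions are total on the ambient type; only their values on subsets
   of the carrier are constrained or used. *)

definition gen_closure_space :: "'a set \<Rightarrow> ('a set \<Rightarrow> 'a set) \<Rightarrow> bool" where
  "gen_closure_space X cl \<longleftrightarrow> cl \<in> Pow X \<rightarrow> Pow X"

definition isotonic :: "'a set \<Rightarrow> ('a set \<Rightarrow> 'a set) \<Rightarrow> bool" where
  "isotonic X cl \<longleftrightarrow> (\<forall>A B. A \<subseteq> B \<and> B \<subseteq> X \<longrightarrow> cl A \<subseteq> cl B)"

definition pointwise_symmetric :: "'a set \<Rightarrow> ('a set \<Rightarrow> 'a set) \<Rightarrow> bool" where
  "pointwise_symmetric X cl \<longleftrightarrow> (\<forall>x\<in>X. \<forall>y\<in>X. x \<in> cl {y} \<longrightarrow> y \<in> cl {x})"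

definition cl_separated :: "('a set \<Rightarrow> 'a set) \<Rightarrow> 'a set \<Rightarrow> 'a set \<Rightarrow> bool" where
  "cl_separated cl A B \<longleftrightarrow> A \<inter> cl B = {} \<and> cl A \<inter> B = {}"

(* The preimage of B under f : X \<rightarrow> Y is f -` B \<inter> X. *)

definition cl_continuous ::
  "'a set \<Rightarrow> ('a set \<Rightarrow> 'a set) \<Rightarrow> 'b set \<Rightarrow> ('b set \<Rightarrow> 'b set) \<Rightarrow> ('a \<Rightarrow> 'b) \<Rightarrow> bool" where
  "cl_continuous X clX Y clY f \<longleftrightarrow>
     (\<forall>B. B \<subseteq> Y \<longrightarrow> clX (f -` B \<inter> X) \<subseteq> f -` (clY B) \<inter> X)"

definition nonseparating ::
  "'a set \<Rightarrow> ('a set \<Rightarrow> 'a set) \<Rightarrow> ('b set \<Rightarrow> 'b set) \<Rightarrow> ('a \<Rightarrow> 'b) \<Rightarrow> bool" where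
  "nonseparating X clX clY f \<longleftrightarrow>
     (\<forall>A B. A \<subseteq> X \<and> B \<subseteq> X \<and> \<not> cl_separated clX A B
        \<longrightarrow> \<not> cl_separated clY (f ` A) (f ` B))"

end

theory Submission
  imports Defs
begin

text \<open>
  Non-separation is a symmetric relation: it says that a point of one of the two sets lies in the
  closure of the other, without saying which.  Continuity, in contrast, speaks of the one-sided
  relation \<open>x \<in> cl A\<close>.  For isotonic closures, continuity amounts to the preservation of this
  one-sided relation by images (\<open>continuous_image_closure\<close>), and applying this to both sides
  yields that non-separation is preserved too.  For the converse, \<open>x \<in> cl A\<close> only gives that the
  images of \<open>{x}\<close> and \<open>A\<close> are not separated; pointwise symmetry of the codomain recovers the
  lost direction when one of the two sets is a singleton
  (\<open>mem_closure_if_not_separated_singleton\<close>).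
\<close>

text \<open>If \<open>x\<close> is not itself in \<open>cl B\<close>, then some \<open>y \<in> B\<close> is in \<open>cl {x}\<close>; symmetry turns this into
  \<open>x \<in> cl {y}\<close>, and isotonicity enlarges \<open>{y}\<close> to \<open>B\<close>.\<close>

lemma mem_closure_if_not_separated_singleton:
  assumes "isotonic Y cl" and "pointwise_symmetric Y cl"
    and "x \<in> Y" and "B \<subseteq> Y"
    and "\<not> cl_separated cl {x} B"
  shows "x \<in> cl B"
proof (rule ccontr)
  assume "x \<notin> cl B"
  then obtain y where "y \<in> B" "y \<in> cl {x}"
    using assms(5) by (auto simp: cl_separated_def)
  then have "x \<in> cl {y}"
    using assms(2-4) by (auto simp: pointwise_symmetric_def)
  moreover have "cl {y} \<subseteq> cl B"
    using assms(1,4) \<open>y \<in> B\<close> by (simp add: isotonic_def)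
  ultimately show False
    using \<open>x \<notin> cl B\<close> by blast
qed

lemma continuous_image_closure:
  assumes "isotonic X clX" and "f \<in> X \<rightarrow> Y"
    and "cl_continuous X clX Y clY f" and "A \<subseteq> X"
  shows "f ` clX A \<subseteq> clY (f ` A)"
proof -
  have "clX A \<subseteq> clX (f -` (f ` A) \<inter> X)"
    using assms(4) by (intro assms(1)[unfolded isotonic_def, rule_format]) auto
  also have "\<dots> \<subseteq> f -` clY (f ` A) \<inter> X"
    using assms(2,4) by (intro assms(3)[unfolded cl_continuous_def, rule_format]) auto
  finally show ?thesis
    by blast
qed

lemma nonseparating_if_continuous:
  assumes "isotonic X clX" and "f \<in> X \<rightarrow> Y"
    and "cl_continuous X clX Y clY f"
  shows "nonseparating X clX clY f"
  unfolding nonseparating_def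
proof (intro allI impI)
  fix A B
  assume AB: "A \<subseteq> X \<and> B \<subseteq> X \<and> \<not> cl_separated clX A B"
  have "f ` clX A \<subseteq> clY (f ` A)" "f ` clX B \<subseteq> clY (f ` B)"
    using continuous_image_closure[OF assms] AB by blast+
  then show "\<not> cl_separated clY (f ` A) (f ` B)"
    using AB unfolding cl_separated_def by blast
qed

text \<open>A point \<open>x\<close> of the closure of the preimage of \<open>B\<close> is not separated from that preimage, so its
  image is not separated from a subset of \<open>B\<close>, and the singleton case applies.\<close>

lemma continuous_if_nonseparating:
  assumes "gen_closure_space X clX"
    and "isotonic Y clY" and "pointwise_symmetric Y clY" and "f \<in> X \<rightarrow> Y"
    and "nonseparating X clX clY f"
  shows "cl_continuous X clX Y clY f"
  unfolding cl_continuous_def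
proof (intro allI impI subsetI)
  fix B x
  let ?A = "f -` B \<inter> X"
  assume "B \<subseteq> Y" and x: "x \<in> clX ?A"
  have "x \<in> X"
    using assms(1) x unfolding gen_closure_space_def by blast
  have "\<not> cl_separated clX {x} ?A"
    using x by (auto simp: cl_separated_def)
  then have "\<not> cl_separated clY (f ` {x}) (f ` ?A)"
    using assms(5) \<open>x \<in> X\<close> unfolding nonseparating_def by blast
  then have "f x \<in> clY (f ` ?A)"
    using mem_closure_if_not_separated_singleton[OF assms(2,3), of "f x" "f ` ?A"]
      assms(4) \<open>x \<in> X\<close> by auto
  moreover have "clY (f ` ?A) \<subseteq> clY B"
    using \<open>B \<subseteq> Y\<close> by (intro assms(2)[unfolded isotonic_def, rule_format]) auto
  ultimately show "x \<in> f -` clY B \<inter> X"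
    using \<open>x \<in> X\<close> by blast
qed

theorem corollary3:
  fixes X :: "'a set" and clX :: "'a set \<Rightarrow> 'a set"
    and Y :: "'b set" and clY :: "'b set \<Rightarrow> 'b set"
    and f :: "'a \<Rightarrow> 'b"
  assumes "gen_closure_space X clX"
    and "gen_closure_space Y clY"
    and "isotonic X clX"
    and "isotonic Y clY"
    and "pointwise_symmetric Y clY"
    and "f \<in> X \<rightarrow> Y"
  shows "nonseparating X clX clY f \<longleftrightarrow> cl_continuous X clX Y clY f"
  using continuous_if_nonseparating[OF assms(1,4,5,6)]
    nonseparating_if_continuous[OF assms(3,6)] by blast

end
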